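(* Let $n\geq 2$. The minimum number of $n\times n$ matrices in Jordan form over $\mathbb R$ which form a hypercyclic tuple is $n+1$; that is, the smallest $k\in\mathbb N$ for which there exists a hypercyclic $k$-tuple $(T_1,\ldots,T_k)$ of $n\times n$ matrices in Jordan form over $\mathbb R$ is $k=n+1$.
   Context: $\mathbb N$ denotes the positive integers and $\mathbb N_0=\mathbb N\cup\{0\}$. For $l\in\mathbb N$ and $\gamma\in\mathbb R$, $\mathrm{Jrd}_{l,\gamma}$ denotes the $l\times l$ Jordan block with eigenvalue $\gamma$: the diagonal entries equal $\gamma$, the entries on the first superdiagonal equal $1$, and all other entries are $0$. A $k$-tuple of $n\times n$ matrices in Jordan form over $\mathbb R$ is a tuple $(T_1,\ldots,T_k)$ in which all matrices have the same block structure, $T_\nu=\mathrm{Jrd}_{n_1,\gamma_\nu^{(1)}}\oplus\cdots\oplus\mathrm{Jrd}_{n_p,\gamma_\nu^{(p)}}$ (block-diagonal direct sum), where $n_1+\cdots+n_p=n$, the numbers $p,n_1,\ldots,n_p$ do not depend on $\nu$ (so the matrices commute), $\gamma_\nu^{(b)}\in\mathbb R$, and $n_b>1$ for at least one $b$ (tuples of diagonal matrices are excluded). A $k$-tuple $T=(T_1,\ldots,T_k)$ of commuting $n\times n$ real matrices is called hypercyclic if there exists a vector $x\in\mathbb R^n$ such that the set $\{T_1^{m_1}T_2^{m_2}\cdots T_k^{m_k}x : m_1,\ldots,m_k\in\mathbb N_0\}$ is dense in $\mathbb R^n$. *)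

theory Defs
  imports "HOL-Analysis.Abstract_Euclidean_Space" "Jordan_Normal_Form.Jordan_Normal_Form"
begin

text \<open>A tuple \<open>(T\<^sub>1, \<dots>, T\<^sub>k)\<close> is represented by the list \<open>[T\<^sub>1, \<dots>, T\<^sub>k]\<close>.
  The block sizes \<open>ns\<close> are common to all matrices of the tuple; \<open>\<gamma> \<nu> b\<close> is the
  eigenvalue of block \<open>b\<close> of the matrix at position \<open>\<nu>\<close> (both counted from 0).
  At least one block has size greater than 1.\<close>

definition jordan_tuple :: "nat \<Rightarrow> real mat list \<Rightarrow> bool" where
  "jordan_tuple n Ts \<longleftrightarrow>
     (\<exists>ns (\<gamma> :: nat \<Rightarrow> nat \<Rightarrow> real).
        (\<forall>l\<in>set ns. 1 \<le> l) \<and> sum_list ns = n \<and> (\<exists>l\<in>set ns. 1 < l) \<and>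
        (\<forall>\<nu><length Ts. Ts ! \<nu> = jordan_matrix (map (\<lambda>b. (ns ! b, \<gamma> \<nu> b)) [0..<length ns])))"

text \<open>For \<open>ms = [m\<^sub>1, \<dots>, m\<^sub>k]\<close> this is \<open>T\<^sub>1 ^ m\<^sub>1 * (T\<^sub>2 ^ m\<^sub>2 * \<dots> * (T\<^sub>k ^ m\<^sub>k * 1))\<close>.\<close>

definition tuple_power :: "nat \<Rightarrow> real mat list \<Rightarrow> nat list \<Rightarrow> real mat" where
  "tuple_power n Ts ms = foldr (\<lambda>(T, m) A. (T ^\<^sub>m m) * A) (zip Ts ms) (1\<^sub>m n)"

definition tuple_orbit :: "nat \<Rightarrow> real mat list \<Rightarrow> real vec \<Rightarrow> real vec set" where
  "tuple_orbit n Ts x = {tuple_power n Ts ms *\<^sub>v x | ms. length ms = length Ts}"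

text \<open>The type \<open>real vec\<close> carries no topology. The topological space \<open>Euclidean_space n\<close>
  consists of the functions \<open>nat \<Rightarrow> real\<close> that vanish outside \<open>{..<n}\<close>, so density
  is stated there, after extending vectors by zero.\<close>

definition vec_to_fun :: "real vec \<Rightarrow> nat \<Rightarrow> real" where
  "vec_to_fun v = (\<lambda>i. if i < dim_vec v then vec_index v i else 0)"

definition dense_in_Rn :: "nat \<Rightarrow> real vec set \<Rightarrow> bool" where
  "dense_in_Rn n S \<longleftrightarrow>
     S \<subseteq> carrier_vec n \<and>
     Euclidean_space n closure_of (vec_to_fun ` S) = topspace (Euclidean_space n)"

definition hypercyclic_tuple :: "nat \<Rightarrow> real mat list \<Rightarrow> bool" where
  "hypercyclic_tuple n Ts \<longleftrightarrow>
     set Ts \<subseteq> carrier_mat n n \<and>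
     (\<forall>A\<in>set Ts. \<forall>B\<in>set Ts. A * B = B * A) \<and>
     (\<exists>x\<in>carrier_vec n. dense_in_Rn n (tuple_orbit n Ts x))"

end

theory Submission
  imports Defs "HOL-Analysis.Kronecker_Approximation_Theorem"
    "HOL-Computational_Algebra.Formal_Power_Series"
begin

text \<open>
  On a Jordan block, read from its last coordinate upwards, a matrix with eigenvalue \<open>\<gamma>\<close> acts as
  multiplication by \<open>\<gamma> + X\<close> in \<open>\<real>[[X]] / X\<^sup>l\<close>. Hence \<open>log \<bar>p(0)\<bar>\<close> and the coefficients of \<open>p' / p\<close>
  turn the action of the tuple into translations of \<open>\<real>\<^sup>n\<close>. Any \<open>k \<le> n\<close> vectors of \<open>\<real>\<^sup>n\<close> take
  integer values under some nonzero linear functional; composed with the logarithmic coordinates it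
  is continuous and nonconstant, but takes values in a coset of \<open>\<int>\<close> on the orbit, which is therefore
  not dense.

  For \<open>n + 1\<close> matrices take one block of size \<open>2\<close> and \<open>n - 2\<close> blocks of size \<open>1\<close>. The translation
  vectors of the first block are \<open>(log \<bar>\<gamma>\<bar>, 1 / \<gamma>)\<close>, which is not an arbitrary vector of the plane, but the
  eigenvalues can still be chosen such that \<open>v\<^sub>n = - \<Sum> \<theta>\<^sub>i v\<^sub>i\<close> with \<open>v\<^sub>0, \<dots>, v\<^bsub>n-1\<^esub>\<close> a basis, \<open>\<theta>\<^sub>i > 0\<close> and
  \<open>1, \<theta>\<^sub>0, \<dots>, \<theta>\<^bsub>n-1\<^esub>\<close> rationally independent. By Kronecker's theorem the semigroup generated by
  \<open>v\<^sub>0, \<dots>, v\<^sub>n\<close> is dense, even with prescribed parities of the exponents, and the parities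
  control the signs of the eigenvalues.
\<close>

unbundle no vec_syntax

section \<open>Density and the action of Jordan matrices\<close>

text \<open>Basic neighbourhoods in the product topology restrict only finitely many coordinates, so
  boxes in the first \<open>n\<close> ones are relatively open. Conversely, points of
  \<open>S\<close> in shrinking boxes converge in every coordinate, those from \<open>n\<close> on
  being 0.\<close>

lemma dense_in_Rn_iff:
  "dense_in_Rn n S \<longleftrightarrow> S \<subseteq> carrier_vec n \<and>
     (\<forall>z\<in>carrier_vec n. \<forall>e>0. \<exists>s\<in>S. \<forall>i<n. \<bar>s $ i - z $ i\<bar> < e)"
proof -
  have *: "(Euclidean_space n closure_of (vec_to_fun ` S) = topspace (Euclidean_space n)) \<longleftrightarrow>
     (\<forall>z\<in>carrier_vec n. \<forall>e>0. \<exists>s\<in>S. \<forall>i<n. \<bar>s $ i - z $ i\<bar> < e)" (is "?L \<longleftrightarrow> ?R")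
    if S: "S \<subseteq> carrier_vec n"
  proof
    assume L: ?L
    show ?R
    proof (intro ballI allI impI)
      fix z :: "real vec" and e :: real assume z: "z \<in> carrier_vec n" and e: "e > 0"
      define U where "U = (\<Inter>i\<in>{..<n}. {f :: nat \<Rightarrow> real. \<bar>f i - z $ i\<bar> < e})"
      have "open U" unfolding U_def
        by (intro open_INT finite_lessThan ballI open_Collect_less continuous_intros
            continuous_on_product_coordinates)
      hence "openin (Euclidean_space n) (topspace (Euclidean_space n) \<inter> U)"
        unfolding Euclidean_space_def euclidean_product_topology
        by (auto simp: openin_subtopology)
      moreover have "vec_to_fun z \<in> topspace (Euclidean_space n)"
        using z by (auto simp: topspace_Euclidean_space vec_to_fun_def)
      moreover have "vec_to_fun z \<in> U" using z e by (auto simp: U_def vec_to_fun_def)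
      ultimately obtain s where s: "s \<in> S" "vec_to_fun s \<in> U"
        using L unfolding set_eq_iff in_closure_of by (metis IntD2 IntI imageE)
      have "\<bar>s $ i - z $ i\<bar> < e" if "i < n" for i
        using s S z that by (auto simp: U_def vec_to_fun_def)
      with s show "\<exists>s\<in>S. \<forall>i<n. \<bar>s $ i - z $ i\<bar> < e" by blast
    qed
  next
    assume R: ?R
    have "f \<in> Euclidean_space n closure_of (vec_to_fun ` S)"
      if f: "f \<in> topspace (Euclidean_space n)" for f
    proof -
      define z where "z = vec n f"
      have fz: "f = vec_to_fun z"
        using f by (auto simp: z_def vec_to_fun_def topspace_Euclidean_space)
      have z: "z \<in> carrier_vec n" by (simp add: z_def)
      have "\<exists>s\<in>S. \<forall>i<n. \<bar>s $ i - z $ i\<bar> < inverse (Suc j)" for j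
        using R z by auto
      then obtain s where s: "\<And>j. s j \<in> S"
        and lim: "\<And>i j. i < n \<Longrightarrow> \<bar>s j $ i - z $ i\<bar> < inverse (Suc j)"
        by metis
      have dim: "dim_vec (s j) = n" for j using s S by (metis carrier_vecD subsetD)
      have *: "(\<lambda>j. vec_to_fun (s j) i) \<longlonglongrightarrow> f i" for i
      proof (cases "i < n")
        case True
        have "(\<lambda>j. s j $ i - z $ i) \<longlonglongrightarrow> 0"
          by (rule Lim_null_comparison[OF _ LIMSEQ_inverse_real_of_nat])
             (use lim[OF True] in \<open>auto intro!: eventuallyI less_imp_le\<close>)
        hence "(\<lambda>j. s j $ i) \<longlonglongrightarrow> z $ i" by (simp add: LIM_zero_iff)
        thus ?thesis using True z by (simp add: fz vec_to_fun_def dim)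
      qed (use z in \<open>auto simp: fz vec_to_fun_def dim\<close>)
      have lim': "(\<lambda>j. vec_to_fun (s j)) \<longlonglongrightarrow> f"
        using * by (simp add: limitin_componentwise flip: limitin_canonical_iff euclidean_product_topology)
      have "\<exists>g\<in>vec_to_fun ` S. g \<in> T" if T: "openin (Euclidean_space n) T" "f \<in> T" for T
      proof -
        obtain W where W: "open W" "T = {x. \<forall>i\<ge>n. x i = 0} \<inter> W"
          using T(1)[unfolded Euclidean_space_def euclidean_product_topology openin_open] by blast
        have "f \<in> W" using W T(2) by blast
        from topological_tendstoD[OF lim' W(1) this] have "\<exists>j. vec_to_fun (s j) \<in> W"
          by (rule eventually_happens'[OF sequentially_bot])
        then obtain j where "vec_to_fun (s j) \<in> W" ..
        moreover have "\<forall>i\<ge>n. vec_to_fun (s j) i = 0" by (auto simp: vec_to_fun_def dim)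
        ultimately show ?thesis using W s by blast
      qed
      thus ?thesis using f by (auto simp: in_closure_of)
    qed
    thus ?L using closure_of_subset_topspace[of "Euclidean_space n"] by blast
  qed
  thus ?thesis unfolding dense_in_Rn_def by blast
qed

text \<open>Induction splits off the first block, since the matrix acts on both parts of the vector
  separately. The superdiagonal adds the next coordinate, except in the last row of a block.\<close>

lemma jordan_matrix_mult_vec_index:
  fixes nas :: "(nat \<times> 'a :: comm_ring_1) list"
  assumes "v \<in> carrier_vec (sum_list (map fst nas))" "b < length nas" "i < fst (nas ! b)"
  shows "(jordan_matrix nas *\<^sub>v v) $ (sum_list (map fst (take b nas)) + i) =
    snd (nas ! b) * v $ (sum_list (map fst (take b nas)) + i) +
    (if Suc i < fst (nas ! b) then v $ (sum_list (map fst (take b nas)) + Suc i) else 0)"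
  using assms
proof (induction nas arbitrary: v b)
  case (Cons na nas)
  obtain l a where na: "na = (l, a)" by force
  let ?m = "sum_list (map fst nas)"
  define u w where "u = vec_first v l" and "w = vec_last v ?m"
  have u: "u \<in> carrier_vec l" and w: "w \<in> carrier_vec ?m" by (auto simp: u_def w_def)
  have v: "v = u @\<^sub>v w" unfolding u_def w_def
    by (rule vec_first_last_append[symmetric]) (use Cons.prems na in auto)
  have J: "jordan_matrix (na # nas) *\<^sub>v v = jordan_block l a *\<^sub>v u @\<^sub>v jordan_matrix nas *\<^sub>v w"
    unfolding v na jordan_matrix_Cons
    by (rule mult_mat_vec_split[OF _ _ u w]) auto
  show ?case
  proof (cases b)
    case 0
    hence i: "i < l" using Cons.prems na by simp
    have "(jordan_block l a *\<^sub>v u) $ i =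
      (\<Sum>j\<in>{0..<l}. (if i = j then a * u $ j else 0) + (if Suc i = j then u $ j else 0))"
      using i u by (auto simp: scalar_prod_def intro!: sum.cong)
    also have "\<dots> = a * u $ i + (if Suc i < l then u $ Suc i else 0)"
      using i by (simp add: sum.distrib sum.delta')
    finally show ?thesis unfolding J using 0 i na u w by (simp add: v)
  next
    case (Suc b')
    have b': "b' < length nas" "i < fst (nas ! b')" using Cons.prems Suc by auto
    have le: "sum_list (map fst (take b' nas)) + fst (nas ! b') \<le> ?m"
    proof -
      have "nas = take b' nas @ nas ! b' # drop (Suc b') nas" using b'(1) by (rule id_take_nth_drop)
      from arg_cong[OF this, of "\<lambda>l. sum_list (map fst l)"] show ?thesis by simp
    qed
    show ?thesis unfolding J using Cons.IH[OF w b'] Suc na u w b' le by (simp add: v add.assoc)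
  qed
qed simp

section \<open>The lower bound\<close>

text \<open>A singular matrix has a kernel vector; an invertible one has a preimage of
  \<open>w\<close>, nonzero because \<open>w\<close> is.\<close>

lemma det_0_or_solvable:
  assumes A: "A \<in> carrier_mat n n" and w: "w \<in> carrier_vec n" and w0: "w \<noteq> 0\<^sub>v n"
  shows "\<exists>v\<in>carrier_vec n. v \<noteq> 0\<^sub>v n \<and> (A *\<^sub>v v = 0\<^sub>v n \<or> A *\<^sub>v v = (w :: real vec))"
proof (cases "det A = 0")
  case True
  thus ?thesis using det_0_iff_vec_prod_zero[OF A] by blast
next
  case False
  from det_non_zero_imp_unit[OF A this, of "()"] obtain B
    where B: "B \<in> carrier_mat n n" "A * B = 1\<^sub>m n"
    unfolding Units_def ring_mat_def by auto
  have "A *\<^sub>v (B *\<^sub>v w) = w" using A B w by (metis assoc_mult_mat_vec one_mult_mat_vec)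
  moreover have "B *\<^sub>v w \<in> carrier_vec n" using B w by simp
  moreover have "A *\<^sub>v 0\<^sub>v n = 0\<^sub>v n" using A by (intro eq_vecI) auto
  hence "B *\<^sub>v w \<noteq> 0\<^sub>v n" using calculation(1) w0 by auto
  ultimately show ?thesis by blast
qed

text \<open>With the \<open>L \<nu>\<close> as rows of a square matrix, the preceding dichotomy
  makes all values 0, or the first value 1 and the others 0.\<close>

lemma exists_integral_functional:
  fixes L :: "nat \<Rightarrow> 'i \<Rightarrow> real"
  assumes I: "finite I" "I \<noteq> {}" "k \<le> card I"
  shows "\<exists>f. (\<exists>i\<in>I. f i \<noteq> 0) \<and> (\<forall>\<nu><k. (\<Sum>i\<in>I. f i * L \<nu> i) \<in> \<int>)"
proof -
  let ?n = "card I"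
  from ex_bij_betw_nat_finite[OF I(1)] obtain e where e: "bij_betw e {0..<?n} I" by blast
  have n: "?n > 0" using I by (simp add: card_gt_0_iff)
  \<comment> \<open>Rows from \<open>k\<close> on only fill the matrix up to a square.\<close>
  define A where "A = mat ?n ?n (\<lambda>(\<nu>, j). L \<nu> (e j))"
  have A: "A \<in> carrier_mat ?n ?n" by (simp add: A_def)
  have "unit_vec ?n 0 \<noteq> (0\<^sub>v ?n :: real vec)" using n by (simp add: vec_eq_iff unit_vec_def)
  from det_0_or_solvable[OF A unit_vec_carrier this] obtain v
    where v: "v \<in> carrier_vec ?n" "v \<noteq> 0\<^sub>v ?n"
      and Av: "A *\<^sub>v v = 0\<^sub>v ?n \<or> A *\<^sub>v v = unit_vec ?n 0" by blast
  define f where "f i = v $ (inv_into {0..<?n} e i)" for i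
  have fe: "f (e j) = v $ j" if "j < ?n" for j
    using that e by (simp add: f_def bij_betw_def)
  have "(\<Sum>i\<in>I. f i * L \<nu> i) = (A *\<^sub>v v) $ \<nu>" if "\<nu> < ?n" for \<nu>
  proof -
    have "(\<Sum>i\<in>I. f i * L \<nu> i) = (\<Sum>j\<in>{0..<?n}. f (e j) * L \<nu> (e j))"
      using sum.reindex_bij_betw[OF e, of "\<lambda>i. f i * L \<nu> i"] by simp
    also have "\<dots> = (A *\<^sub>v v) $ \<nu>"
      using that v by (simp add: A_def scalar_prod_def fe mult.commute)
    finally show ?thesis .
  qed
  hence "\<forall>\<nu><k. (\<Sum>i\<in>I. f i * L \<nu> i) \<in> \<int>" using Av I(3) by (auto simp: unit_vec_def)
  moreover obtain j where "j < ?n" "v $ j \<noteq> 0" using v by (auto simp: vec_eq_iff)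
  hence "\<exists>i\<in>I. f i \<noteq> 0" using fe e by (auto simp: bij_betw_def intro!: bexI[of _ "e j"])
  ultimately show ?thesis by blast
qed


section \<open>Logarithmic coordinates of power series\<close>

text \<open>For \<open>p(0) \<noteq> 0\<close> these are the coefficients of \<open>log \<bar>p\<bar>\<close>, the \<open>i\<close>-th one (\<open>i > 0\<close>) multiplied
  by \<open>i\<close>, so that no logarithm of power series is needed.\<close>

definition log_coord :: "real fps \<Rightarrow> nat \<Rightarrow> real" where
  "log_coord p i = (if i = 0 then ln \<bar>fps_nth p 0\<bar> else fps_nth (fps_deriv p * inverse p) (i - 1))"

text \<open>Logarithmic derivatives turn products into sums, as \<open>ln\<close> does in coordinate
  0.\<close>

lemma log_coord_mult:
  assumes "fps_nth p 0 \<noteq> 0" "fps_nth q 0 \<noteq> 0"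
  shows "log_coord (p * q) i = log_coord p i + log_coord q i"
proof -
  have inv: "inverse p * p = 1" "inverse q * q = 1"
    using assms by (simp_all add: inverse_mult_eq_1)
  have "fps_deriv (p * q) * (inverse p * inverse q) =
      (inverse q * q) * (fps_deriv p * inverse p) + (inverse p * p) * (fps_deriv q * inverse q)"
    by (simp add: algebra_simps)
  hence "fps_deriv (p * q) * (inverse p * inverse q) =
      fps_deriv p * inverse p + fps_deriv q * inverse q"
    by (simp add: inv)
  thus ?thesis using assms
    by (auto simp: log_coord_def abs_mult ln_mult fps_inverse_mult)
qed

text \<open>The recursion expresses each coefficient of the inverse by earlier ones, by coefficients
  of the series and by the reciprocal of its constant coefficient, so continuity follows by
  induction.\<close>

lemma tendsto_fps_inverse:
  fixes q :: "real fps"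
  assumes "\<And>j. j \<le> i \<Longrightarrow> ((\<lambda>k. fps_nth (p k) j) \<longlongrightarrow> fps_nth q j) F" and "fps_nth q 0 \<noteq> 0"
  shows "((\<lambda>k. fps_nth (inverse (p k)) i) \<longlongrightarrow> fps_nth (inverse q) i) F"
  using assms(1)
proof (induction i rule: less_induct)
  case (less i)
  \<comment> \<open>This also holds for \<open>fps_nth r 0 = 0\<close>: by
    \<open>inverse 0 = 0\<close> both sides are then 0.\<close>
  have eq: "fps_nth (inverse r) i = (if i = 0 then inverse (fps_nth r 0) else
      - inverse (fps_nth r 0) * (\<Sum>j = 1..i. fps_nth r j * fps_nth (inverse r) (i - j)))" for r :: "real fps"
    by (cases i) (simp_all add: fps_inverse_def)
  show ?case unfolding eq[of q] eq[of "p _"]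
    using less assms(2) by (auto intro!: tendsto_intros)
qed

lemma tendsto_log_coord:
  assumes "\<And>j. j \<le> i \<Longrightarrow> ((\<lambda>k. fps_nth (p k) j) \<longlongrightarrow> fps_nth q j) F" and "fps_nth q 0 \<noteq> 0"
  shows "((\<lambda>k. log_coord (p k) i) \<longlongrightarrow> log_coord q i) F"
  using assms unfolding log_coord_def
  by (auto simp: fps_mult_nth intro!: tendsto_intros tendsto_fps_inverse)

text \<open>Continuity applied to the constant sequence \<open>p\<close>, which converges to
  \<open>q\<close> in all coefficients up to \<open>i\<close>.\<close>

lemma log_coord_cong:
  assumes "\<And>j. j \<le> i \<Longrightarrow> fps_nth p j = fps_nth q j" and "fps_nth q 0 \<noteq> 0"
  shows "log_coord p i = log_coord q i"
proof -
  have "((\<lambda>k :: nat. log_coord p i) \<longlongrightarrow> log_coord q i) sequentially"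
    by (rule tendsto_log_coord) (use assms in auto)
  thus ?thesis by (simp add: LIMSEQ_const_iff)
qed

lemma log_coord_1 [simp]: "log_coord 1 i = 0"
  by (simp add: log_coord_def)

text \<open>The derivative is a monomial of degree \<open>i - 1\<close> and the inverse has constant
  coefficient 1. Such series realise any value of coordinate \<open>i\<close> while the lower
  coordinates stay 0.\<close>

lemma log_coord_one_plus_X_power:
  assumes "0 < i" "j \<le> i"
  shows "log_coord (1 + fps_const s * fps_X ^ i) j = (if j = i then real i * s else 0)"
proof -
  have "fps_deriv (1 + fps_const s * fps_X ^ i :: real fps) = fps_const (real i * s) * fps_X ^ (i - 1)"
    by (simp add: fps_deriv_power' mult_ac flip: fps_of_nat fps_const_mult)
  thus ?thesis using assms
    by (auto simp: log_coord_def fps_X_power_mult_nth mult.assoc)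
qed

section \<open>Propagation of properties along an orbit\<close>

lemma tuple_power_carrier:
  assumes "set Ts \<subseteq> carrier_mat n n"
  shows "tuple_power n Ts ms \<in> carrier_mat n n"
  using assms
proof (induction Ts arbitrary: ms)
  case (Cons T Ts)
  thus ?case by (cases ms) (auto simp: tuple_power_def intro!: mult_carrier_mat pow_carrier_mat)
qed (simp add: tuple_power_def)

lemma tuple_power_Cons_mult_vec:
  assumes "set (T # Ts) \<subseteq> carrier_mat n n" "x \<in> carrier_vec n"
  shows "tuple_power n (T # Ts) (m # ms) *\<^sub>v x = (T ^\<^sub>m m) *\<^sub>v (tuple_power n Ts ms *\<^sub>v x)"
  using assms tuple_power_carrier[of Ts n ms]
  by (simp add: tuple_power_def assoc_mult_mat_vec[of _ n n _ n] pow_carrier_mat)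

lemma pow_mat_mult_vec_Suc:
  assumes "A \<in> carrier_mat n n" "v \<in> carrier_vec n"
  shows "(A ^\<^sub>m Suc m) *\<^sub>v v = (A ^\<^sub>m m) *\<^sub>v (A *\<^sub>v v)"
  using assms by (simp add: assoc_mult_mat_vec[of _ n n _ n] pow_carrier_mat)

lemma pow_mat_mult_vec_invariant:
  assumes A: "A \<in> carrier_mat n n" and "v \<in> carrier_vec n" "Q v"
    and step: "\<And>v. v \<in> carrier_vec n \<Longrightarrow> Q v \<Longrightarrow> Q (A *\<^sub>v v)"
  shows "(A ^\<^sub>m m) *\<^sub>v v \<in> carrier_vec n \<and> Q ((A ^\<^sub>m m) *\<^sub>v v)"
  using assms(2,3)
proof (induction m arbitrary: v)
  case (Suc m)
  have "A *\<^sub>v v \<in> carrier_vec n" using A Suc.prems by simp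
  from Suc.IH[OF this step[OF Suc.prems]] show ?case
    unfolding pow_mat_mult_vec_Suc[OF A Suc.prems(1)] .
qed (use A in simp)

text \<open>Orbit points arise from \<open>x\<close> by applying members of \<open>Ts\<close> one
  after another.\<close>

lemma tuple_orbit_invariant:
  assumes "y \<in> tuple_orbit n Ts x" "set Ts \<subseteq> carrier_mat n n" "x \<in> carrier_vec n" "Q x"
    and step: "\<And>T v. T \<in> set Ts \<Longrightarrow> v \<in> carrier_vec n \<Longrightarrow> Q v \<Longrightarrow> Q (T *\<^sub>v v)"
  shows "y \<in> carrier_vec n \<and> Q y"
proof -
  have "tuple_power n Ts ms *\<^sub>v x \<in> carrier_vec n \<and> Q (tuple_power n Ts ms *\<^sub>v x)"
    if "length ms = length Ts" for ms
    using that assms(2) step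
  proof (induction Ts arbitrary: ms)
    case Nil
    thus ?case using assms by (simp add: tuple_power_def)
  next
    case (Cons T Ts)
    then obtain m ms' where ms: "ms = m # ms'" by (cases ms) auto
    have "tuple_power n Ts ms' *\<^sub>v x \<in> carrier_vec n \<and> Q (tuple_power n Ts ms' *\<^sub>v x)"
      using Cons ms by auto
    thus ?case unfolding ms tuple_power_Cons_mult_vec[OF Cons.prems(2) assms(3)]
      by (intro pow_mat_mult_vec_invariant) (use Cons.prems in auto)
  qed
  thus ?thesis using assms(1) unfolding tuple_orbit_def by blast
qed

section \<open>Blocks as truncated power series\<close>

lemma sum_list_take_add_nth_le:
  fixes ns :: "nat list"
  assumes "b < length ns"
  shows "sum_list (take b ns) + ns ! b \<le> sum_list ns"
proof -
  from assms have "ns = take b ns @ ns ! b # drop (Suc b) ns" by (rule id_take_nth_drop)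
  from arg_cong[OF this, of sum_list] show ?thesis by simp
qed

lemma exists_vec_with_blocks:
  "\<exists>v\<in>carrier_vec (sum_list ns). \<forall>b<length ns. \<forall>i<ns ! b.
     v $ (sum_list (take b ns) + i) = (w b i :: 'a)"
proof (induction ns arbitrary: w)
  case (Cons l ns)
  from Cons.IH[of "\<lambda>b. w (Suc b)"] obtain v where
    v: "v \<in> carrier_vec (sum_list ns)"
       "\<And>b i. b < length ns \<Longrightarrow> i < ns ! b \<Longrightarrow> v $ (sum_list (take b ns) + i) = w (Suc b) i"
    by blast
  have "(vec l (w 0) @\<^sub>v v) $ (sum_list (take b (l # ns)) + i) = w b i"
    if b: "b < length (l # ns)" "i < (l # ns) ! b" for b i
  proof (cases b)
    case (Suc b')
    with b sum_list_take_add_nth_le[of b' ns] v(1) v(2)[of b' i] show ?thesis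
      by (simp add: index_append_vec(1) add.assoc)
  qed (use b v in auto)
  thus ?case using v(1) by (intro bexI[of _ "vec l (w 0) @\<^sub>v v"]) auto
qed (auto intro: exI[of _ "vec 0 (\<lambda>_. undefined)"])

text \<open>Reading a block from its last coordinate upwards turns the Jordan block with eigenvalue
  \<open>\<gamma>\<close> into multiplication by \<open>\<gamma> + X\<close> modulo a power of \<open>X\<close>.\<close>

definition block_fps :: "nat list \<Rightarrow> nat \<Rightarrow> real vec \<Rightarrow> real fps" where
  "block_fps ns b v =
     Abs_fps (\<lambda>i. if i < ns ! b then v $ (sum_list (take b ns) + (ns ! b - Suc i)) else 0)"

text \<open>In reversed order the superdiagonal, which fetches the next coordinate, becomes the
  shift of coefficients by \<open>X\<close>.\<close>

lemma block_fps_jordan_matrix: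
  assumes v: "v \<in> carrier_vec (sum_list ns)" and b: "b < length ns" and i: "i < ns ! b"
  shows "fps_nth (block_fps ns b
      (jordan_matrix (map (\<lambda>b. (ns ! b, \<gamma> b)) [0..<length ns]) *\<^sub>v v)) i =
    fps_nth ((fps_const (\<gamma> b) + fps_X) * block_fps ns b v) i"
proof -
  let ?nas = "map (\<lambda>b. (ns ! b, \<gamma> b)) [0..<length ns]"
  have fst: "map fst ?nas = ns" by (simp add: o_def map_nth)
  have take: "map fst (take b ?nas) = take b ns" by (metis fst take_map)
  have "fst (?nas ! b) = ns ! b" "snd (?nas ! b) = \<gamma> b" using b by auto
  with jordan_matrix_mult_vec_index[of v ?nas b "ns ! b - Suc i"] v b i
  have "(jordan_matrix ?nas *\<^sub>v v) $ (sum_list (take b ns) + (ns ! b - Suc i)) =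
      \<gamma> b * v $ (sum_list (take b ns) + (ns ! b - Suc i)) +
      (if Suc (ns ! b - Suc i) < ns ! b then v $ (sum_list (take b ns) + Suc (ns ! b - Suc i)) else 0)"
    by (simp only: fst take length_map length_upt)
  \<comment> \<open>The next coordinate carries the coefficient of index \<open>i - 1\<close>. For
    \<open>i = 0\<close> it lies outside the block, matching the zero constant coefficient of a
    multiple of \<open>X\<close>.\<close>
  moreover have "Suc (ns ! b - Suc i) = ns ! b - i" using i by simp
  moreover have "Suc (i - Suc 0) = i" if "i \<noteq> 0" using that by simp
  ultimately show ?thesis using i
    by (auto simp: block_fps_def algebra_simps)
qed

lemma exists_vec_with_block_fps:
  "\<exists>v\<in>carrier_vec (sum_list ns). \<forall>b<length ns. \<forall>i<ns ! b.
     fps_nth (block_fps ns b v) i = fps_nth (p b) i"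
proof -
  obtain v where v: "v \<in> carrier_vec (sum_list ns)"
    "\<And>b i. b < length ns \<Longrightarrow> i < ns ! b \<Longrightarrow>
       v $ (sum_list (take b ns) + i) = fps_nth (p b) (ns ! b - Suc i)"
    using exists_vec_with_blocks[of ns "\<lambda>b i. fps_nth (p b) (ns ! b - Suc i)"] by blast
  have "fps_nth (block_fps ns b v) i = fps_nth (p b) i" if "b < length ns" "i < ns ! b" for b i
    using v(2)[OF that(1), of "ns ! b - Suc i"] that by (simp add: block_fps_def)
  thus ?thesis using v(1) by blast
qed

section \<open>Orbits of at most \<open>n\<close> matrices are not dense\<close>

lemma jordan_tuple_hypercyclic_length:
  assumes J: "jordan_tuple n Ts" and H: "hypercyclic_tuple n Ts"
  shows "n + 1 \<le> length Ts"
proof (rule ccontr)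
  assume "\<not> n + 1 \<le> length Ts"
  hence k: "length Ts \<le> n" by simp
  from J obtain ns \<gamma> where pos: "\<And>l. l \<in> set ns \<Longrightarrow> 1 \<le> l" and n: "sum_list ns = n"
    and ex: "\<exists>l\<in>set ns. 1 < l"
    and Ts: "\<And>\<nu>. \<nu> < length Ts \<Longrightarrow>
      Ts ! \<nu> = jordan_matrix (map (\<lambda>b. (ns ! b, \<gamma> \<nu> b)) [0..<length ns])"
    unfolding jordan_tuple_def by blast
  from H obtain x where carr: "set Ts \<subseteq> carrier_mat n n" and x: "x \<in> carrier_vec n"
    and dense: "dense_in_Rn n (tuple_orbit n Ts x)"
    unfolding hypercyclic_tuple_def by blast
  define p where "p = length ns"
  have ns_pos: "0 < ns ! b" if "b < p" for b
    using pos[of "ns ! b"] that by (simp add: p_def)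
  define I where "I = (SIGMA b:{..<p}. {..<ns ! b})"
  have finI: "finite I" by (simp add: I_def)
  have "card I = (\<Sum>b<p. ns ! b)" by (simp add: I_def)
  also have "\<dots> = n" using n by (simp add: p_def sum_list_sum_nth atLeast0LessThan)
  finally have cardI: "card I = n" .
  have "I \<noteq> {}" using ex ns_pos by (fastforce simp: I_def p_def in_set_conv_nth)
  \<comment> \<open>\<open>L \<nu>\<close> is the translation by which \<open>Ts ! \<nu>\<close>
    acts in logarithmic coordinates.\<close>
  define L where "L \<nu> = (\<lambda>(b, i). log_coord (fps_const (\<gamma> \<nu> b) + fps_X) i)" for \<nu>
  from exists_integral_functional[OF finI \<open>I \<noteq> {}\<close>, of "length Ts" L] k cardI obtain f
    where f0: "\<exists>bi\<in>I. f bi \<noteq> 0" and fL: "\<And>\<nu>. \<nu> < length Ts \<Longrightarrow> (\<Sum>bi\<in>I. f bi * L \<nu> bi) \<in> \<int>"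
    by auto
  define g where "g v = (\<Sum>(b, i)\<in>I. f (b, i) * log_coord (block_fps ns b v) i)" for v
  \<comment> \<open>On \<open>U\<close> the logarithmic coordinates of all blocks are meaningful and
    continuous.\<close>
  define U where "U = {v \<in> carrier_vec n. \<forall>b<p. fps_nth (block_fps ns b v) 0 \<noteq> 0}"

  \<comment> \<open>The invariant is conditional because eigenvalues may be 0. Constant coefficients
    get multiplied by eigenvalues, so if the image of \<open>v\<close> lies in \<open>U\<close>,
    then \<open>v\<close> does too and the eigenvalues are nonzero.\<close>
  have orbit: "y \<in> carrier_vec n \<and> (y \<in> U \<longrightarrow> x \<in> U \<and> g y - g x \<in> \<int>)"
    if "y \<in> tuple_orbit n Ts x" for y
    using that carr x
  proof (rule tuple_orbit_invariant)
    fix T v assume T: "T \<in> set Ts" and v: "v \<in> carrier_vec n"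
      and Q: "v \<in> U \<longrightarrow> x \<in> U \<and> g v - g x \<in> \<int>"
    from T obtain \<nu> where \<nu>: "\<nu> < length Ts" "T = Ts ! \<nu>" by (metis in_set_conv_nth)
    have act: "fps_nth (block_fps ns b (T *\<^sub>v v)) i =
        fps_nth ((fps_const (\<gamma> \<nu> b) + fps_X) * block_fps ns b v) i" if "b < p" "i < ns ! b" for b i
      unfolding \<nu> Ts[OF \<nu>(1)] using block_fps_jordan_matrix v n that by (simp add: p_def)
    show "T *\<^sub>v v \<in> U \<longrightarrow> x \<in> U \<and> g (T *\<^sub>v v) - g x \<in> \<int>"
    proof
      assume TU: "T *\<^sub>v v \<in> U"
      have nz: "\<gamma> \<nu> b \<noteq> 0" "fps_nth (block_fps ns b v) 0 \<noteq> 0" if "b < p" for b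
        using TU act[OF that ns_pos[OF that]] that by (auto simp: U_def)
      hence "v \<in> U" using v by (simp add: U_def)
      have "log_coord (block_fps ns b (T *\<^sub>v v)) i = L \<nu> (b, i) + log_coord (block_fps ns b v) i"
        if bi: "b < p" "i < ns ! b" for b i
      proof -
        have "log_coord (block_fps ns b (T *\<^sub>v v)) i =
            log_coord ((fps_const (\<gamma> \<nu> b) + fps_X) * block_fps ns b v) i"
          by (rule log_coord_cong) (use act bi nz[OF bi(1)] in auto)
        also have "\<dots> = L \<nu> (b, i) + log_coord (block_fps ns b v) i"
          unfolding L_def prod.case by (rule log_coord_mult) (use nz[OF bi(1)] in auto)
        finally show ?thesis .
      qed
      hence "g (T *\<^sub>v v) = (\<Sum>(b, i)\<in>I. f (b, i) * (L \<nu> (b, i) + log_coord (block_fps ns b v) i))"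
        unfolding g_def by (intro sum.cong) (auto simp: I_def)
      also have "\<dots> = (\<Sum>bi\<in>I. f bi * L \<nu> bi) + g v"
        unfolding g_def by (simp add: split_def distrib_left sum.distrib)
      finally have *: "g (T *\<^sub>v v) - g x = (\<Sum>bi\<in>I. f bi * L \<nu> bi) + (g v - g x)" by simp
      show "x \<in> U \<and> g (T *\<^sub>v v) - g x \<in> \<int>"
        unfolding * using fL[OF \<nu>(1)] Q \<open>v \<in> U\<close> by (intro conjI Ints_add) auto
    qed
  qed simp

  \<comment> \<open>Orbit points tending to \<open>z\<close> eventually lie in \<open>U\<close>,
    where \<open>g\<close> is continuous, and \<open>\<int>\<close> is closed.\<close>
  have int: "g z - g x \<in> \<int>" if z: "z \<in> U" for z
  proof -
    have zc: "z \<in> carrier_vec n" using z by (simp add: U_def)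
    have "\<exists>s\<in>tuple_orbit n Ts x. \<forall>i<n. \<bar>s $ i - z $ i\<bar> < inverse (Suc j)" for j
      using dense zc unfolding dense_in_Rn_iff by auto
    then obtain s where s: "\<And>j. s j \<in> tuple_orbit n Ts x"
      and lim: "\<And>i j. i < n \<Longrightarrow> \<bar>s j $ i - z $ i\<bar> < inverse (Suc j)"
      by metis
    have coord: "(\<lambda>j. s j $ i) \<longlonglongrightarrow> z $ i" if "i < n" for i
    proof -
      have "(\<lambda>j. s j $ i - z $ i) \<longlonglongrightarrow> 0"
        by (rule Lim_null_comparison[OF _ LIMSEQ_inverse_real_of_nat])
           (use lim[OF that] in \<open>auto intro!: eventuallyI less_imp_le\<close>)
      thus ?thesis by (simp add: LIM_zero_iff)
    qed
    have blk: "(\<lambda>j. fps_nth (block_fps ns b (s j)) i) \<longlonglongrightarrow> fps_nth (block_fps ns b z) i"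
      if "b < p" for b i
      using sum_list_take_add_nth_le[of b ns] that coord n by (auto simp: block_fps_def p_def)
    have "(\<lambda>j. g (s j)) \<longlonglongrightarrow> g z"
      unfolding g_def split_def
      by (intro tendsto_sum tendsto_mult tendsto_const tendsto_log_coord blk)
         (use z in \<open>auto simp: I_def U_def\<close>)
    hence "(\<lambda>j. g (s j) - g x) \<longlonglongrightarrow> g z - g x" by (intro tendsto_intros)
    moreover have "\<forall>\<^sub>F j in sequentially. \<forall>b\<in>{..<p}. fps_nth (block_fps ns b (s j)) 0 \<noteq> 0"
      by (intro eventually_ball_finite ballI tendsto_imp_eventually_ne[OF blk])
         (use z in \<open>auto simp: U_def\<close>)
    hence "\<forall>\<^sub>F j in sequentially. g (s j) - g x \<in> \<int>"
      by eventually_elim (use orbit[OF s] in \<open>auto simp: U_def\<close>)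
    ultimately show ?thesis
      by (intro Lim_in_closed_set[of "\<int>"]) auto
  qed

  from f0 obtain b0 where b0: "b0 < p" "\<exists>i<ns ! b0. f (b0, i) \<noteq> 0" by (auto simp: I_def)
  \<comment> \<open>The last index with nonzero weight is taken because altering coefficient
    \<open>i0\<close> may also change later logarithmic coordinates, which then have weight 0 in
    \<open>g\<close>.\<close>
  define N where "N = {i. i < ns ! b0 \<and> f (b0, i) \<noteq> 0}"
  have N: "finite N" "N \<noteq> {}" using b0 by (auto simp: N_def)
  define i0 where "i0 = Max N"
  have i0: "i0 < ns ! b0" "f (b0, i0) \<noteq> 0" using Max_in[OF N] by (auto simp: N_def i0_def)
  have i0_max: "f (b0, i) = 0" if "i0 < i" "i < ns ! b0" for i
  proof -
    have "i \<notin> N" using Max_ge[OF N(1), of i] that(1) unfolding i0_def by linarith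
    thus ?thesis using that(2) by (simp add: N_def)
  qed
  \<comment> \<open>Coordinate \<open>i0\<close> of \<open>q s\<close> becomes \<open>s\<close> and
    the lower ones 0; dividing by \<open>i0\<close> cancels the factor built into
    \<open>log_coord\<close>.\<close>
  define q :: "real \<Rightarrow> real fps" where
    "q s = (if i0 = 0 then fps_const (exp s) else 1 + fps_const (s / i0) * fps_X ^ i0)" for s
  have q0: "fps_nth (q s) 0 \<noteq> 0" for s by (simp add: q_def)
  have log_q: "log_coord (q s) i = (if i = i0 then s else 0)" if "i \<le> i0" for i s
    using that log_coord_one_plus_X_power[of i0 i "s / i0"]
    by (auto simp: q_def log_coord_def)
  have "\<exists>z\<in>U. g z = s * f (b0, i0)" for s
  proof -
    obtain z where z: "z \<in> carrier_vec n"
      and blk: "\<And>b i. b < p \<Longrightarrow> i < ns ! b \<Longrightarrow>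
        fps_nth (block_fps ns b z) i = fps_nth (if b = b0 then q s else 1) i"
      using exists_vec_with_block_fps[of ns "\<lambda>b. if b = b0 then q s else 1"] n
      by (auto simp: p_def)
    have "z \<in> U" using z blk ns_pos q0 by (auto simp: U_def)
    have "(case bi of (b, i) \<Rightarrow> f (b, i) * log_coord (block_fps ns b z) i) =
        (if bi = (b0, i0) then s * f (b0, i0) else 0)" if biI: "bi \<in> I" for bi
    proof -
      obtain b i where bi: "bi = (b, i)" "b < p" "i < ns ! b"
        using biI by (cases bi) (auto simp: I_def)
      have "log_coord (block_fps ns b z) i = log_coord (if b = b0 then q s else 1) i"
        by (rule log_coord_cong) (use blk bi q0 in auto)
      thus ?thesis using log_q[of i s] i0_max[of i] bi by (cases "i \<le> i0") auto
    qed
    hence "g z = (\<Sum>bi\<in>I. if bi = (b0, i0) then s * f (b0, i0) else 0)"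
      unfolding g_def by (rule sum.cong[OF refl])
    also have "\<dots> = s * f (b0, i0)" using finI b0 i0 by (simp add: I_def)
    finally show ?thesis using \<open>z \<in> U\<close> by blast
  qed
  \<comment> \<open>The values 0 and \<open>1 / 2\<close> cannot both differ from \<open>g x\<close>
    by integers.\<close>
  from this[of 0] this[of "1 / (2 * f (b0, i0))"] obtain z z' where
    "z \<in> U" "g z = 0" "z' \<in> U" "g z' = 1 / 2" using i0 by auto
  with int[of z] int[of z'] have "1 / 2 - g x - (0 - g x) \<in> \<int>" by (metis Ints_diff)
  hence "(1 / 2 :: real) \<in> \<int>" by simp
  thus False by (auto elim!: Ints_cases simp: field_simps)
qed

section \<open>Dense semigroups from Kronecker's theorem\<close>

text \<open>An integer relation, split by the signs of its coefficients, equates two products of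
  prime powers, and unique factorisation forces all exponents to be 0. Base 2 turns the prime 2 into
  the number 1.\<close>

lemma independent_log_primes:
  fixes S :: "nat set"
  assumes prime: "\<And>p. p \<in> S \<Longrightarrow> prime p"
  shows "module.independent (\<lambda>r x. of_int r * x) ((\<lambda>p. log 2 (real p)) ` S)"
proof -
  interpret Modules.module "\<lambda>r x. of_int r * x :: real"
    by (simp add: Modules.module.intro distrib_left mult.commute)
  have gt1: "real p > 1" if "p \<in> S" for p
    using prime_gt_1_nat[OF prime[OF that]] by simp
  have inj: "inj_on (\<lambda>p. log 2 (real p)) S"
  proof (rule inj_onI)
    fix p q assume pq: "p \<in> S" "q \<in> S" "log 2 (real p) = log 2 (real q)"
    hence "ln (real p) = ln (real q)" by (simp add: log_def)
    thus "p = q" using gt1[OF pq(1)] gt1[OF pq(2)] by simp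
  qed
  show ?thesis
    unfolding independent_explicit_module
  proof (intro allI impI)
    fix t u x
    assume "finite t" "t \<subseteq> (\<lambda>p. log 2 (real p)) ` S"
      and 0: "(\<Sum>x\<in>t. of_int (u x) * x) = 0" and x: "x \<in> t"
    then obtain S' where S': "S' \<subseteq> S" "finite S'" "t = (\<lambda>p. log 2 (real p)) ` S'"
      using finite_subset_image[of t "\<lambda>p. log 2 (real p)" S] by blast
    define e where "e p = u (log 2 (real p))" for p :: nat
    have "(\<Sum>p\<in>S'. of_int (e p) * log 2 (real p)) = 0"
      using 0 by (simp add: sum.reindex[OF inj_on_subset[OF inj S'(1)]] e_def S'(3))
    hence "(\<Sum>p\<in>S'. of_int (e p) * ln (real p)) = 0"
      by (simp add: log_def flip: sum_divide_distrib)
    moreover have "of_int (e p) = real (nat (e p)) - real (nat (- e p))" for p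
      by (cases "e p \<ge> 0") auto
    ultimately have "(\<Sum>p\<in>S'. real (nat (e p)) * ln (real p)) = (\<Sum>p\<in>S'. real (nat (- e p)) * ln (real p))"
      by (simp add: left_diff_distrib sum_subtractf)
    moreover have "ln (real (\<Prod>p\<in>S'. p ^ f p)) = (\<Sum>p\<in>S'. real (f p) * ln (real p))" for f
    proof -
      have "ln (\<Prod>p\<in>S'. real p ^ f p) = (\<Sum>p\<in>S'. ln (real p ^ f p))"
        using gt1 S'(1) by (intro ln_prod[OF S'(2)]) force
      also have "\<dots> = (\<Sum>p\<in>S'. real (f p) * ln (real p))"
        by (intro sum.cong refl ln_realpow)
      finally show ?thesis by simp
    qed
    ultimately have ln_eq: "ln (real (\<Prod>p\<in>S'. p ^ nat (e p))) = ln (real (\<Prod>p\<in>S'. p ^ nat (- e p)))"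
      by simp
    have pos: "(\<Prod>p\<in>S'. p ^ f p) > 0" for f
      using prime S'(1) by (intro prod_pos) (auto simp: prime_gt_0_nat)
    have "real (\<Prod>p\<in>S'. p ^ f p) > 0" for f
      using pos      by (simp only: of_nat_0_less_iff)
    with ln_eq have "real (\<Prod>p\<in>S'. p ^ nat (e p)) = real (\<Prod>p\<in>S'. p ^ nat (- e p))"
      by (simp only: ln_inj_iff)
    hence eq: "(\<Prod>p\<in>S'. p ^ nat (e p)) = (\<Prod>p\<in>S'. p ^ nat (- e p))"
      by (simp only: of_nat_eq_iff)
    have "e p = 0" if "p \<in> S'" for p
    proof -
      have "multiplicity p (\<Prod>p\<in>S'. p ^ f p) = f p" for f
        using multiplicity_prod_prime_powers[of S' p f] prime S'(1,2) that by auto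
      from this[of "\<lambda>p. nat (e p)"] this[of "\<lambda>p. nat (- e p)"] show ?thesis
        unfolding eq by linarith
    qed
    with x S'(3) show "u x = 0" by (auto simp: e_def)
  qed
qed

text \<open>Kronecker's theorem yields integers that may be negative. Adding many copies of a
  simultaneous Dirichlet approximation with \<open>q > 0\<close> makes them nonnegative at a small
  cost in accuracy.\<close>

lemma Kronecker_thm_nat:
  fixes \<theta> t :: "nat \<Rightarrow> real"
  assumes indep: "module.independent (\<lambda>r x. of_int r * x) (\<theta> ` {..n})"
    and inj: "inj_on \<theta> {..n}" and \<theta>n: "\<theta> n = 1"
    and pos: "\<And>i. i < n \<Longrightarrow> \<theta> i > 0" and \<epsilon>: "\<epsilon> > 0"
  obtains k :: nat and m :: "nat \<Rightarrow> nat"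
  where "\<And>i. i < n \<Longrightarrow> \<bar>real (m i) - real k * \<theta> i - t i\<bar> < \<epsilon>"
proof -
  from Kronecker_thm_2[OF indep inj \<theta>n, of "\<epsilon> / 2" "\<lambda>i. - t i"] \<epsilon> obtain k0 m0 where
    0: "\<And>i. i < n \<Longrightarrow> \<bar>of_int k0 * \<theta> i - of_int (m0 i) + t i\<bar> < \<epsilon> / 2" by auto
  \<comment> \<open>\<open>of_int K \<ge> C\<close> will give
    \<open>of_int K * \<theta> i \<ge> \<bar>t i\<bar> + \<epsilon>\<close>, hence
    \<open>M i > 0\<close>.\<close>
  define C where "C = (\<Sum>i<n. (\<bar>t i\<bar> + \<epsilon>) / \<theta> i)"
  obtain B :: nat where B: "real B > \<bar>of_int k0\<bar> + \<bar>C\<bar> + 1"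
    using reals_Archimedean2 by blast
  \<comment> \<open>\<open>N\<close> is chosen after \<open>B\<close>, so that \<open>B\<close>
    Dirichlet errors below \<open>1 / N\<close> add up to less than
    \<open>\<epsilon> / 2\<close>.\<close>
  obtain N :: nat where N: "real N > 2 * real B / \<epsilon>" using reals_Archimedean2 by blast
  have B0: "real B > 0" using B by linarith
  have "2 * real B / \<epsilon> > 0" using B0 \<epsilon> by simp
  hence N0: "N > 0" using N by linarith
  from Dirichlet_approx_simult[OF N0, where \<theta> = \<theta> and n = n] obtain q p where
    q: "0 < q" and p: "\<And>i. i < n \<Longrightarrow> \<bar>of_int q * \<theta> i - of_int (p i)\<bar> < 1 / N" by metis
  define K where "K = k0 + int B * q"
  define M where "M i = m0 i + int B * p i" for i
  have "real B * 1 \<le> real B * of_int q" using q B0 by (intro mult_left_mono) auto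
  hence KC: "of_int K \<ge> C" "of_int K \<ge> (0 :: real)" using B by (auto simp: K_def)
  have close: "\<bar>of_int (M i) - of_int K * \<theta> i - t i\<bar> < \<epsilon>" if "i < n" for i
  proof -
    have "real B * \<bar>of_int q * \<theta> i - of_int (p i)\<bar> \<le> real B * (1 / N)"
      using p[OF that] B0 by (intro mult_left_mono) auto
    also have "\<dots> < \<epsilon> / 2" using N N0 \<epsilon> by (simp add: field_simps)
    finally have "\<bar>real B * (of_int q * \<theta> i - of_int (p i))\<bar> < \<epsilon> / 2" by (simp add: abs_mult)
    with 0[OF that] have "\<bar>(of_int k0 * \<theta> i - of_int (m0 i) + t i) +
        real B * (of_int q * \<theta> i - of_int (p i))\<bar> < \<epsilon>" by linarith
    thus ?thesis by (simp add: K_def M_def algebra_simps abs_minus_commute)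
  qed
  have "M i \<ge> 0" if "i < n" for i
  proof -
    have "(\<bar>t i\<bar> + \<epsilon>) / \<theta> i \<le> C"
      unfolding C_def using that pos \<epsilon> by (intro member_le_sum) (auto simp: less_imp_le)
    hence "(\<bar>t i\<bar> + \<epsilon>) / \<theta> i \<le> of_int K" using KC by linarith
    hence "\<bar>t i\<bar> + \<epsilon> \<le> of_int K * \<theta> i" using pos[OF that] by (simp add: field_simps)
    with close[OF that] have "of_int (M i) > (0 :: real)" by linarith
    thus ?thesis by simp
  qed
  moreover have "K \<ge> 0" using KC by simp
  ultimately show ?thesis using close by (intro that[of "\<lambda>i. nat (M i)" "nat K"]) simp
qed

text \<open>Numbers \<open>\<theta>\<^sub>i\<close> for which the vectors \<open>e\<^sub>1, \<dots>, e\<^sub>n, - \<Sum> \<theta>\<^sub>i e\<^sub>i\<close> generate a dense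
  subsemigroup of \<open>\<real>\<^sup>n\<close>, even with prescribed parities of the multiplicities.\<close>

lemma exists_dense_semigroup:
  "\<exists>\<theta>. (\<forall>i<n. \<theta> i > 1) \<and> (\<forall>(t :: nat \<Rightarrow> real) (a :: nat \<Rightarrow> nat) (b :: nat). \<exists>k m.
     (\<forall>i<n. (\<lambda>j. real (m j i) - real (k j) * \<theta> i) \<longlonglongrightarrow> t i) \<and>
     (\<forall>j. \<forall>i<n. even (m j i + a i)) \<and> (\<forall>j. even (k j + b)))"
proof -
  \<comment> \<open>Only odd primes are used: \<open>log 2 2 = 1\<close> is reserved for
    \<open>\<theta> n\<close>, and the other logarithms exceed 1.\<close>
  have "infinite ({p :: nat. prime p} - {2})" using primes_infinite by simp
  from infinite_arbitrarily_large[OF this, of n] obtain S where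
    S: "finite S" "card S = n" "S \<subseteq> {p :: nat. prime p} - {2}" by blast
  from ex_bij_betw_nat_finite[OF S(1)] S(2) obtain e where e: "bij_betw e {0..<n} S" by blast
  define P where "P i = (if i < n then e i else 2)" for i
  define \<theta> where "\<theta> i = log 2 (real (P i))" for i
  have "e ` {..<n} = S" "inj_on e {..<n}" using e by (auto simp: bij_betw_def atLeast0LessThan)
  hence P: "P ` {..n} = insert 2 S" "inj_on P {..n}"
    using S by (auto simp: P_def inj_on_def image_iff Bex_def)
  have \<theta>P: "\<theta> ` {..n} = (\<lambda>p. log 2 (real p)) ` (P ` {..n})" by (auto simp: \<theta>_def)
  have prime: "prime p" if "p \<in> insert 2 S" for p using that S by auto
  have indep: "module.independent (\<lambda>r x. of_int r * x) (\<theta> ` {..n})"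
    unfolding \<theta>P P(1) by (rule independent_log_primes[OF prime])
  have "P i > 0" if "i \<le> n" for i using prime P(1) that by (metis atMost_iff imageI prime_gt_0_nat)
  hence inj: "inj_on \<theta> {..n}"
    using P(2) by (auto simp: inj_on_def \<theta>_def log_def)
  have \<theta>n: "\<theta> n = 1" by (simp add: \<theta>_def P_def)
  have gt: "\<theta> i > 1" if "i < n" for i
  proof -
    have "P i \<in> S" using that \<open>e ` {..<n} = S\<close> by (auto simp: P_def)
    hence "prime (P i)" "P i \<noteq> 2" using S by auto
    hence "P i > 2" using prime_ge_2_nat[of "P i"] by simp
    thus ?thesis by (simp add: \<theta>_def)
  qed
  have "\<exists>k m. (\<forall>i<n. \<bar>real (m i) - real k * \<theta> i - t i\<bar> < \<epsilon>) \<and>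
      (\<forall>i<n. even (m i + a i)) \<and> even (k + b)" if \<epsilon>: "\<epsilon> > 0"
    for t :: "nat \<Rightarrow> real" and a :: "nat \<Rightarrow> nat" and b :: nat and \<epsilon> :: real
  proof -
    \<comment> \<open>Multiplicities \<open>2 * m i + a i mod 2\<close> and
      \<open>2 * k + b mod 2\<close> have the required parities; \<open>t'\<close> is the target for
      \<open>m\<close> and \<open>k\<close> that this substitution turns into
      \<open>t\<close>.\<close>
    define t' where "t' i = (t i - real (a i mod 2) + real (b mod 2) * \<theta> i) / 2" for i
    have pos: "\<theta> i > 0" if "i < n" for i using gt[OF that] by simp
    obtain k m where km: "\<And>i. i < n \<Longrightarrow> \<bar>real (m i) - real k * \<theta> i - t' i\<bar> < \<epsilon> / 2"
      by (rule Kronecker_thm_nat[where t = t', OF indep inj \<theta>n pos half_gt_zero[OF \<epsilon>]]) blast+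
    have "\<bar>real (2 * m i + a i mod 2) - real (2 * k + b mod 2) * \<theta> i - t i\<bar> < \<epsilon>" if "i < n" for i
    proof -
      have *: "real (2 * m i + a i mod 2) - real (2 * k + b mod 2) * \<theta> i - t i =
          2 * (real (m i) - real k * \<theta> i - t' i)"
        by (simp add: t'_def field_simps)
      show ?thesis unfolding * abs_mult using km[OF that] by simp
    qed
    moreover have "even (2 * k + b mod 2 + b)" for k b :: nat by presburger
    ultimately show ?thesis
      by (intro exI[of _ "2 * k + b mod 2"] exI[of _ "\<lambda>i. 2 * m i + a i mod 2"]) auto
  qed
  hence approx: "\<exists>k m. (\<forall>i<n. \<bar>real (m i) - real k * \<theta> i - t i\<bar> < inverse (Suc j)) \<and>
      (\<forall>i<n. even (m i + a i)) \<and> even (k + b)"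
    for t :: "nat \<Rightarrow> real" and a :: "nat \<Rightarrow> nat" and b j :: nat by simp
  have "\<exists>k m. (\<forall>i<n. (\<lambda>j. real (m j i) - real (k j) * \<theta> i) \<longlonglongrightarrow> t i) \<and>
     (\<forall>j. \<forall>i<n. even (m j i + a i)) \<and> (\<forall>j. even (k j + b))"
    for t :: "nat \<Rightarrow> real" and a :: "nat \<Rightarrow> nat" and b :: nat
  proof -
    have "\<forall>j. \<exists>km. (\<forall>i<n. \<bar>real (snd km i) - real (fst km) * \<theta> i - t i\<bar> < inverse (Suc j)) \<and>
        (\<forall>i<n. even (snd km i + a i)) \<and> even (fst km + b)"
      using approx[of t _ a b] by (simp add: split_paired_Ex)
    from choice[OF this] obtain km where km: "\<And>j.
        (\<forall>i<n. \<bar>real (snd (km j) i) - real (fst (km j)) * \<theta> i - t i\<bar> < inverse (Suc j)) \<and>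
        (\<forall>i<n. even (snd (km j) i + a i)) \<and> even (fst (km j) + b)"
      by blast
    have "(\<lambda>j. real (snd (km j) i) - real (fst (km j)) * \<theta> i) \<longlonglongrightarrow> t i" if "i < n" for i
    proof (rule LIM_zero_cancel, rule Lim_null_comparison[OF _ LIMSEQ_inverse_real_of_nat])
      show "\<forall>\<^sub>F j in sequentially. norm (real (snd (km j) i) - real (fst (km j)) * \<theta> i - t i)
          \<le> inverse (real (Suc j))"
        using km that by (auto intro!: eventuallyI less_imp_le)
    qed
    with km show ?thesis by (intro exI[of _ "\<lambda>j. fst (km j)"] exI[of _ "\<lambda>j. snd (km j)"]) simp
  qed
  with gt show ?thesis by blast
qed

section \<open>A hypercyclic tuple\<close>

text \<open>By the intermediate value theorem, with a positive value at 1. The equation lets a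
  single eigenvalue \<open>\<gamma>\<close> of the last matrix supply both prescribed components
  \<open>log \<bar>\<gamma>\<bar>\<close> and \<open>1 / \<gamma>\<close>.\<close>

lemma exists_log_balance:
  fixes c K :: real
  assumes "c > 0" "K > 0" "K + c > 1"
  shows "\<exists>y>0. ln y \<noteq> 0 \<and> c * ln y + ln (K + c * y) = 0"
proof -
  define f where "f y = c * ln y + ln (K + c * y)" for y
  \<comment> \<open>At \<open>y0\<close> the first summand is \<open>- ln (K + c)\<close>, and
    \<open>y0 \<le> 1\<close> bounds the second by \<open>ln (K + c)\<close>.\<close>
  define y0 where "y0 = exp (- ln (K + c) / c)"
  have y0: "0 < y0" "y0 \<le> 1" using assms by (auto simp: y0_def)
  have pos: "0 < K + c * y" if "y > 0" for y using assms that by (simp add: add_pos_pos)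
  have "K + c * y0 \<le> K + c" using assms y0 by simp
  hence "ln (K + c * y0) \<le> ln (K + c)" using pos[OF y0(1)] assms by simp
  hence "f y0 \<le> 0" using assms by (simp add: f_def y0_def)
  moreover have f1: "f 1 > 0" using assms by (simp add: f_def)
  moreover have "continuous_on {y0..1} f"
    unfolding f_def
  proof (intro continuous_intros ballI)
    fix y assume "y \<in> {y0..1}"
    hence "y > 0" using y0 by simp
    thus "y \<noteq> 0" "K + c * y \<noteq> 0" using pos[of y] by auto
  qed
  ultimately obtain y where y: "y0 \<le> y" "y \<le> 1" "f y = 0" using IVT'[of f y0 0 1] y0 by auto
  hence "y \<noteq> 1" using f1 by auto
  moreover have "y > 0" using y y0 by linarith
  ultimately show ?thesis using y by (auto simp: f_def)
qed

section \<open>Matrices with one block of size two\<close>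

text \<open>Coordinates \<open>0\<close> and \<open>1\<close> carry the block of size \<open>2\<close>; \<open>E j\<close> is the eigenvalue at coordinate
  \<open>j \<ge> 1\<close>.\<close>

definition size_two_block_jordan :: "nat \<Rightarrow> (nat \<Rightarrow> real) \<Rightarrow> real mat" where
  "size_two_block_jordan n E = jordan_matrix
     (map (\<lambda>b. ((2 # replicate (n - 2) 1) ! b, E (Suc b))) [0..<length (2 # replicate (n - 2) (1 :: nat))])"

lemma size_two_block_jordan_carrier:
  assumes "n \<ge> 2"
  shows "size_two_block_jordan n E \<in> carrier_mat n n"
proof -
  let ?ns = "2 # replicate (n - 2) (1 :: nat)"
  have "map fst (map (\<lambda>b. (?ns ! b, E (Suc b))) [0..<length ?ns]) = ?ns"
    unfolding map_map o_def fst_conv by (rule map_nth)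
  moreover have "sum_list ?ns = n" using assms by (simp add: sum_list_replicate)
  ultimately show ?thesis using jordan_matrix_carrier unfolding size_two_block_jordan_def by metis
qed

lemma size_two_block_jordan_mult_vec:
  assumes n: "n \<ge> 2" and v: "v \<in> carrier_vec n"
  shows "(size_two_block_jordan n E *\<^sub>v v) $ 0 = E 1 * v $ 0 + v $ 1"
    and "\<And>j. 0 < j \<Longrightarrow> j < n \<Longrightarrow> (size_two_block_jordan n E *\<^sub>v v) $ j = E j * v $ j"
proof -
  let ?ns = "2 # replicate (n - 2) (1 :: nat)"
  let ?nas = "map (\<lambda>b. (?ns ! b, E (Suc b))) [0..<length ?ns]"
  have fst: "map fst ?nas = ?ns"
    unfolding map_map o_def fst_conv by (rule map_nth)
  have take: "map fst (take b ?nas) = take b ?ns" for b by (metis fst take_map)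
  have sum: "sum_list ?ns = n" using n by (simp add: sum_list_replicate)
  have *: "(size_two_block_jordan n E *\<^sub>v v) $ (sum_list (take b ?ns) + i) =
      E (Suc b) * v $ (sum_list (take b ?ns) + i) +
      (if Suc i < ?ns ! b then v $ (sum_list (take b ?ns) + Suc i) else 0)"
    if "b < length ?ns" "i < ?ns ! b" for b i
  proof -
    have "fst (?nas ! b) = ?ns ! b" "snd (?nas ! b) = E (Suc b)" using that(1)
      by (simp_all only: nth_map length_upt minus_nat.diff_0 nth_upt add_0 fst_conv snd_conv)
    with jordan_matrix_mult_vec_index[of v ?nas b i] v that show ?thesis
      unfolding size_two_block_jordan_def by (simp only: fst take sum length_map length_upt minus_nat.diff_0)
  qed
  show "(size_two_block_jordan n E *\<^sub>v v) $ 0 = E 1 * v $ 0 + v $ 1" using *[of 0 0] by simp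
  fix j assume j: "0 < j" "j < n"
  show "(size_two_block_jordan n E *\<^sub>v v) $ j = E j * v $ j"
  proof (cases "j = 1")
    case True
    thus ?thesis using *[of 0 1] by simp
  next
    case False
    define b where "b = j - 2"
    have "j = b + 2" "b < n - 2" using False j by (auto simp: b_def)
    thus ?thesis using *[of "Suc b" 0] by (simp add: sum_list_replicate)
  qed
qed

lemma mat_eqI_mult_vec:
  fixes A B :: "'a :: comm_ring_1 mat"
  assumes A: "A \<in> carrier_mat m n" and B: "B \<in> carrier_mat m n"
    and eq: "\<And>v. v \<in> carrier_vec n \<Longrightarrow> A *\<^sub>v v = B *\<^sub>v v"
  shows "A = B"
proof (rule mat_col_eqI)
  have col: "col C j = C *\<^sub>v unit_vec n j" if "C \<in> carrier_mat m n" "j < n" for C :: "'a mat" and j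
    using col_mult2[OF that(1) one_carrier_mat that(2)] that by simp
  fix j assume "j < dim_col B"
  hence "j < n" using B by simp
  thus "col A j = col B j" using A B eq by (simp add: col)
qed (use A B in auto)

text \<open>Only coordinate 0 mixes, and there both orders give
  \<open>E 1 * F 1 * v $ 0 + (E 1 + F 1) * v $ 1\<close>.\<close>

lemma size_two_block_jordan_commute:
  assumes n: "n \<ge> 2"
  shows "size_two_block_jordan n E * size_two_block_jordan n F = size_two_block_jordan n F * size_two_block_jordan n E"
proof -
  note c = size_two_block_jordan_carrier[OF n]
  note act = size_two_block_jordan_mult_vec[OF n]
  have prod: "size_two_block_jordan n E * size_two_block_jordan n F \<in> carrier_mat n n" for E F
    by (rule mult_carrier_mat[OF c c])
  show ?thesis
  proof (rule mat_eqI_mult_vec[OF prod prod])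
    fix v :: "real vec" assume v: "v \<in> carrier_vec n"
    have "size_two_block_jordan n E *\<^sub>v (size_two_block_jordan n F *\<^sub>v v) =
        size_two_block_jordan n F *\<^sub>v (size_two_block_jordan n E *\<^sub>v v)" (is "?l = ?r")
    proof (rule eq_vecI)
      have cv: "size_two_block_jordan n E *\<^sub>v v \<in> carrier_vec n" for E
        by (rule mult_mat_vec_carrier[OF c v])
      fix j assume "j < dim_vec ?r"
      hence j: "j < n" by (simp add: carrier_matD[OF c])
      have "1 < n" using n by simp
      thus "?l $ j = ?r $ j"
        by (cases "j = 0") (use j in \<open>simp_all add: act[OF cv] act[OF v] algebra_simps\<close>)
    qed (simp add: carrier_matD[OF c])
    thus "(size_two_block_jordan n E * size_two_block_jordan n F) *\<^sub>v v =
        (size_two_block_jordan n F * size_two_block_jordan n E) *\<^sub>v v"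
      by (simp add: assoc_mult_mat_vec[OF c c v])
  qed
qed

text \<open>Each application moves the ratio \<open>r\<close> of coordinates 0 and 1 by
  \<open>1 / E 1\<close>, the second logarithmic coordinate of the block.\<close>

lemma size_two_block_jordan_pow_mult_vec:
  assumes n: "n \<ge> 2" and E1: "E 1 \<noteq> 0" and "v \<in> carrier_vec n" "v $ 0 = v $ 1 * r"
  shows "\<And>j. 0 < j \<Longrightarrow> j < n \<Longrightarrow> ((size_two_block_jordan n E ^\<^sub>m m) *\<^sub>v v) $ j = E j ^ m * v $ j"
    and "((size_two_block_jordan n E ^\<^sub>m m) *\<^sub>v v) $ 0 =
      ((size_two_block_jordan n E ^\<^sub>m m) *\<^sub>v v) $ 1 * (r + real m / E 1)"
  using assms(3,4)
proof (induction m arbitrary: v r)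
  case 0
  note c = size_two_block_jordan_carrier[OF n]
  { case 1 thus ?case using c[THEN carrier_matD(1)] by simp }
  { case 2 thus ?case using c[THEN carrier_matD(1)] by simp }
next
  case (Suc m)
  note c = size_two_block_jordan_carrier[OF n, of E]
  let ?w = "\<lambda>v. size_two_block_jordan n E *\<^sub>v v"
  have w: "?w v \<in> carrier_vec n" if "v \<in> carrier_vec n" for v using c that by simp
  note act = size_two_block_jordan_mult_vec[OF n]
  have w0: "?w v $ 0 = ?w v $ 1 * (r + 1 / E 1)" if "v \<in> carrier_vec n" "v $ 0 = v $ 1 * r" for v r
  proof -
    have "?w v $ 0 = E 1 * (v $ 1 * r) + v $ 1" "?w v $ 1 = E 1 * v $ 1"
      using act(1)[OF that(1), of E] act(2)[OF that(1), of 1 E] that(2) n by simp_all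
    thus ?thesis using E1 by (simp only: distrib_left) simp
  qed
  { case 1
    from Suc.IH(1)[OF 1(1,2) w[OF 1(3)] w0[OF 1(3,4)]] show ?case
      unfolding pow_mat_mult_vec_Suc[OF c 1(3)] act(2)[OF 1(3,1,2)] by simp
  }
  { case 2
    from Suc.IH(2)[OF w[OF 2(1)] w0[OF 2]] show ?case
      unfolding pow_mat_mult_vec_Suc[OF c 2(1)] by (simp add: add_divide_distrib add.assoc)
  }
qed

text \<open>The start vector has ratio 0 and ones from coordinate 1 on, so the accumulated
  translations and products appear unchanged.\<close>

lemma tuple_power_size_two_block_jordan:
  fixes E :: "'u \<Rightarrow> nat \<Rightarrow> real" and m :: "'u \<Rightarrow> nat"
  assumes n: "n \<ge> 2" and E1: "\<And>u. E u 1 \<noteq> 0"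
  defines "x \<equiv> vec n (\<lambda>j. if j = 0 then 0 else 1)"
  defines "v us \<equiv> tuple_power n (map (\<lambda>u. size_two_block_jordan n (E u)) us) (map m us) *\<^sub>v x"
  shows "v us \<in> carrier_vec n" (is ?A)
    and "\<And>j. 0 < j \<Longrightarrow> j < n \<Longrightarrow> v us $ j = (\<Prod>u\<leftarrow>us. E u j ^ m u)" (is "\<And>j. _ \<Longrightarrow> _ \<Longrightarrow> ?B j")
    and "v us $ 0 = v us $ 1 * (\<Sum>u\<leftarrow>us. real (m u) / E u 1)" (is ?C)
proof -
  note c = size_two_block_jordan_carrier[OF n]
  have x: "x \<in> carrier_vec n" by (simp add: x_def)
  have "?A \<and> (\<forall>j. 0 < j \<longrightarrow> j < n \<longrightarrow> ?B j) \<and> ?C"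
  proof (induction us)
    case Nil
    thus ?case using n by (auto simp: v_def tuple_power_def x_def)
  next
    case (Cons u us)
    have carr: "set (map (\<lambda>u. size_two_block_jordan n (E u)) (u # us)) \<subseteq> carrier_mat n n"
      using c by auto
    have v: "v (u # us) = (size_two_block_jordan n (E u) ^\<^sub>m m u) *\<^sub>v v us"
      using tuple_power_Cons_mult_vec[OF carr[unfolded list.map(2)] x] by (simp add: v_def)
    note p = size_two_block_jordan_pow_mult_vec[where m = "m u" and E = "E u", OF n E1,
        of "v us" "\<Sum>u\<leftarrow>us. real (m u) / E u 1"]
    show ?case
      using Cons.IH p(1) p(2) mult_mat_vec_carrier[OF pow_carrier_mat[OF c]] unfolding v
      by (simp add: add.commute)
  qed
  thus ?A "\<And>j. 0 < j \<Longrightarrow> j < n \<Longrightarrow> ?B j" ?C by blast+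
qed

lemma prod_list_map_upt: "prod_list (map f [0..<n]) = (\<Prod>i<n. f i :: 'a :: comm_monoid_mult)"
  by (induction n) simp_all

lemma sum_list_map_upt: "sum_list (map f [0..<n]) = (\<Sum>i<n. f i :: 'a :: comm_monoid_add)"
  by (induction n) simp_all

section \<open>Density for \<open>n + 1\<close> matrices\<close>

lemma exists_hypercyclic_jordan_tuple:
  assumes n: "n \<ge> 2"
  shows "\<exists>Ts. length Ts = n + 1 \<and> jordan_tuple n Ts \<and> hypercyclic_tuple n Ts"
proof -
  obtain \<theta> where \<theta>: "\<And>i. i < n \<Longrightarrow> \<theta> i > 1"
    and dense: "\<And>(t :: nat \<Rightarrow> real) (a :: nat \<Rightarrow> nat) (b :: nat). \<exists>k m.
     (\<forall>i<n. (\<lambda>j. real (m j i) - real (k j) * \<theta> i) \<longlonglongrightarrow> t i) \<and>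
     (\<forall>j. \<forall>i<n. even (m j i + a i)) \<and> (\<forall>j. even (k j + b))"
    using exists_dense_semigroup[of n] by blast
  define K where "K = (\<Sum>i\<in>{1..<n}. \<theta> i)"
  have "K > 0" unfolding K_def
  proof (rule sum_pos)
    show "\<theta> i > 0" if "i \<in> {1..<n}" for i using \<theta>[of i] that by simp
  qed (use n in auto)
  moreover have \<theta>0: "\<theta> 0 > 1" using \<theta> n by simp
  ultimately obtain Y where Y: "Y > 0" "ln Y \<noteq> 0" "\<theta> 0 * ln Y + ln (K + \<theta> 0 * Y) = 0"
    using exists_log_balance[of "\<theta> 0" K] by auto
  \<comment> \<open>In the first block, \<open>1 / Y\<close> translates by
    \<open>(- ln Y, Y)\<close>, the eigenvalue 1 by \<open>(0, 1)\<close> and \<open>- 1 / W\<close>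
    by \<open>(- ln W, - W)\<close>. The equation for \<open>Y\<close> makes the last vector
    \<open>- \<theta> 0\<close> times the first minus \<open>K\<close> times the second.\<close>
  define W where "W = K + \<theta> 0 * Y"
  have W: "W > 0" "ln W = - \<theta> 0 * ln Y"
    using \<open>K > 0\<close> \<theta>0 Y by (auto simp: W_def add_pos_pos)
  \<comment> \<open>Matrices 0 to \<open>n - 1\<close> give a basis of translation vectors, matrix
    \<open>n\<close> minus their combination with coefficients \<open>\<theta>\<close>. Negative
    eigenvalues let the parity of \<open>m j\<close> set the sign of coordinate
    \<open>j \<ge> 2\<close>, and that of \<open>k\<close> the sign of coordinate 1.\<close>
  define E where "E u j = (if j = 1 then if u = 0 then 1 / Y else if u = n then - 1 / W else 1
      else if u = j then - exp 1 else if u = n then exp (- \<theta> j) else 1)" for u j :: nat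
  have E1: "E u 1 \<noteq> 0" for u using Y W by (simp add: E_def)
  define Ts where "Ts = map (\<lambda>u. size_two_block_jordan n (E u)) [0..<n + 1]"
  define x :: "real vec" where "x = vec n (\<lambda>j. if j = 0 then 0 else 1)"
  have len: "length Ts = n + 1" by (simp add: Ts_def)

  have jordan: "jordan_tuple n Ts"
    unfolding jordan_tuple_def
  proof (intro exI conjI allI impI)
    let ?ns = "2 # replicate (n - 2) (1 :: nat)"
    show "\<forall>l\<in>set ?ns. 1 \<le> l" "\<exists>l\<in>set ?ns. 1 < l" by auto
    show "sum_list ?ns = n" using n by (simp add: sum_list_replicate)
    fix \<nu> assume "\<nu> < length Ts"
    hence "Ts ! \<nu> = size_two_block_jordan n (E \<nu>)" by (simp add: Ts_def del: upt_Suc)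
    thus "Ts ! \<nu> = jordan_matrix (map (\<lambda>b. (?ns ! b, E \<nu> (Suc b))) [0..<length ?ns])"
      unfolding size_two_block_jordan_def .
  qed

  \<comment> \<open>Apart from signs, the exponents enter only through the differences
    \<open>real (m i) - real k * \<theta> i\<close>.\<close>
  have orbit: "\<exists>v\<in>tuple_orbit n Ts x.
      (\<forall>j. 2 \<le> j \<longrightarrow> j < n \<longrightarrow> v $ j = (- 1) ^ m j * exp (real (m j) - real k * \<theta> j)) \<and>
      v $ 1 = (- 1) ^ k * exp (- (real (m 0) - real k * \<theta> 0) * ln Y) \<and>
      v $ 0 = v $ 1 * ((real (m 0) - real k * \<theta> 0) * Y + (\<Sum>i\<in>{1..<n}. real (m i) - real k * \<theta> i))"
    for m :: "nat \<Rightarrow> nat" and k :: nat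
  proof -
    define M where "M u = (if u = n then k else m u)" for u
    define v where "v = tuple_power n Ts (map M [0..<n + 1]) *\<^sub>v x"
    note V = tuple_power_size_two_block_jordan[where E = E and m = M and us = "[0..<n + 1]", OF n E1,
        folded Ts_def x_def, folded v_def]
    have coord: "v $ j = (\<Prod>u<n. E u j ^ m u) * E n j ^ k" if "0 < j" "j < n" for j
      using V(2)[OF that] unfolding prod_list_map_upt by (simp add: M_def)
    have "v $ j = (- 1) ^ m j * exp (real (m j) - real k * \<theta> j)" if "2 \<le> j" "j < n" for j
    proof -
      have "(\<Prod>u<n. E u j ^ m u) = (\<Prod>u<n. if u = j then (- exp 1) ^ m j else 1)"
        using that by (intro prod.cong) (auto simp: E_def)
      also have "\<dots> = (- 1) ^ m j * exp (real (m j))"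
        using that by (simp add: power_minus[of "exp 1"] flip: exp_of_nat_mult)
      finally have "v $ j = (- 1) ^ m j * exp (real (m j)) * exp (- \<theta> j) ^ k"
        using coord[of j] that by (simp add: E_def)
      thus ?thesis by (simp add: exp_diff exp_minus field_simps flip: exp_of_nat_mult)
    qed
    moreover have "v $ 1 = (- 1) ^ k * exp (- (real (m 0) - real k * \<theta> 0) * ln Y)"
    proof -
      have "(\<Prod>u<n. E u 1 ^ m u) = (\<Prod>u<n. if u = 0 then (1 / Y) ^ m 0 else 1)"
        by (intro prod.cong) (auto simp: E_def)
      also have "\<dots> = (1 / Y) ^ m 0" using n by simp
      finally have "v $ 1 = (1 / Y) ^ m 0 * (- 1 / W) ^ k"
        using coord[of 1] n by (simp add: E_def)
      also have "1 / Y = exp (- ln Y)" using Y by (simp add: exp_minus field_simps)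
      also have "- 1 / W = - exp (\<theta> 0 * ln Y)"
        using W exp_ln[OF W(1)] by (simp add: exp_minus field_simps)
      also have "exp (- ln Y) ^ m 0 * (- exp (\<theta> 0 * ln Y)) ^ k =
          (- 1) ^ k * (exp (real (m 0) * (- ln Y)) * exp (real k * (\<theta> 0 * ln Y)))"
        unfolding exp_of_nat_mult power_minus[of "exp (\<theta> 0 * ln Y)"] by simp
      also have "\<dots> = (- 1) ^ k * exp (- (real (m 0) - real k * \<theta> 0) * ln Y)"
        by (simp add: algebra_simps flip: exp_add)
      finally show ?thesis .
    qed
    moreover have "v $ 0 = v $ 1 *
        ((real (m 0) - real k * \<theta> 0) * Y + (\<Sum>i\<in>{1..<n}. real (m i) - real k * \<theta> i))"
    proof -
      have "{..<n} = insert 0 {1..<n}" using n by auto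
      hence "(\<Sum>u<n. real (m u) / E u 1) = real (m 0) * Y + (\<Sum>u\<in>{1..<n}. real (m u) / E u 1)"
        by (simp add: E_def)
      also have "(\<Sum>u\<in>{1..<n}. real (m u) / E u 1) = (\<Sum>u\<in>{1..<n}. real (m u))"
        by (intro sum.cong) (auto simp: E_def)
      finally have "(\<Sum>u<n + 1. real (M u) / E u 1) =
          real (m 0) * Y + (\<Sum>u\<in>{1..<n}. real (m u)) - real k * W"
        using n by (simp add: M_def E_def)
      also have "\<dots> = (real (m 0) - real k * \<theta> 0) * Y + (\<Sum>i\<in>{1..<n}. real (m i) - real k * \<theta> i)"
        by (simp add: W_def K_def sum_subtractf algebra_simps sum_distrib_left)
      finally show ?thesis using V(3) unfolding sum_list_map_upt by simp
    qed
    moreover have "v \<in> tuple_orbit n Ts x"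
      unfolding tuple_orbit_def v_def using len by auto
    ultimately show ?thesis by blast
  qed

  have neg_one: "(- 1) ^ p = ((- 1) ^ q :: real)" if "even (p + q)" for p q :: nat
    using that by (cases "even p") auto
  have sgn: "(- 1) ^ (if r < 0 then 1 else 0 :: nat) * \<bar>r\<bar> = r" for r :: real by simp

  have approx: "\<exists>v\<in>tuple_orbit n Ts x. \<forall>j<n. \<bar>v $ j - z $ j\<bar> < e"
    if nz: "\<And>j. 0 < j \<Longrightarrow> j < n \<Longrightarrow> z $ j \<noteq> 0" and e: "e > 0" for z :: "real vec" and e :: real
  proof -
    \<comment> \<open>Coordinate 1 of the target determines \<open>t0\<close>, each coordinate
      \<open>i \<ge> 2\<close> determines \<open>t i\<close>, and the ratio
      \<open>z $ 0 / z $ 1\<close> then determines \<open>t 1\<close>.\<close>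
    define t0 where "t0 = - ln \<bar>z $ 1\<bar> / ln Y"
    define t where "t i = (if i = 0 then t0
        else if i = 1 then z $ 0 / z $ 1 - t0 * Y - (\<Sum>i\<in>{2..<n}. ln \<bar>z $ i\<bar>) else ln \<bar>z $ i\<bar>)" for i
    obtain k m where
      lim: "\<And>i. i < n \<Longrightarrow> (\<lambda>l. real (m l i) - real (k l) * \<theta> i) \<longlonglongrightarrow> t i"
      and m: "\<And>l i. i < n \<Longrightarrow> even (m l i + (if z $ i < 0 then 1 else 0))"
      and k: "\<And>l. even (k l + (if z $ 1 < 0 then 1 else 0))"
      using dense[of t "\<lambda>i. if z $ i < 0 then 1 else 0" "if z $ 1 < 0 then 1 else 0"] by blast
    from orbit have "\<forall>l. \<exists>v. v \<in> tuple_orbit n Ts x \<and>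
      (\<forall>j. 2 \<le> j \<longrightarrow> j < n \<longrightarrow> v $ j = (- 1) ^ m l j * exp (real (m l j) - real (k l) * \<theta> j)) \<and>
      v $ 1 = (- 1) ^ k l * exp (- (real (m l 0) - real (k l) * \<theta> 0) * ln Y) \<and>
      v $ 0 = v $ 1 * ((real (m l 0) - real (k l) * \<theta> 0) * Y +
        (\<Sum>i\<in>{1..<n}. real (m l i) - real (k l) * \<theta> i))" by blast
    from choice[OF this] obtain v where v: "\<And>l. v l \<in> tuple_orbit n Ts x"
      and vj: "\<And>l j. 2 \<le> j \<Longrightarrow> j < n \<Longrightarrow>
        v l $ j = (- 1) ^ m l j * exp (real (m l j) - real (k l) * \<theta> j)"
      and v1: "\<And>l. v l $ 1 = (- 1) ^ k l * exp (- (real (m l 0) - real (k l) * \<theta> 0) * ln Y)"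
      and v0: "\<And>l. v l $ 0 = v l $ 1 * ((real (m l 0) - real (k l) * \<theta> 0) * Y +
        (\<Sum>i\<in>{1..<n}. real (m l i) - real (k l) * \<theta> i))" by blast
    have z1: "z $ 1 \<noteq> 0" using nz n by simp
    have lim1: "(\<lambda>l. v l $ 1) \<longlonglongrightarrow> z $ 1"
    proof -
      have "(\<lambda>l. (- 1) ^ (if z $ 1 < 0 then 1 else 0 :: nat) *
          exp (- (real (m l 0) - real (k l) * \<theta> 0) * ln Y)) \<longlonglongrightarrow>
          (- 1) ^ (if z $ 1 < 0 then 1 else 0 :: nat) * exp (- t 0 * ln Y)"
        by (intro tendsto_intros lim) (use n in simp)
      also have "exp (- t 0 * ln Y) = \<bar>z $ 1\<bar>" using Y z1 by (simp add: t_def t0_def)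
      finally show ?thesis unfolding v1 neg_one[OF k] sgn .
    qed
    have "(\<lambda>l. v l $ j) \<longlonglongrightarrow> z $ j" if j: "j < n" for j
    proof -
      consider "j = 0" | "j = 1" | "2 \<le> j" by linarith
      thus ?thesis
      proof cases
        case 1
        have "{1..<n} = insert 1 {2..<n}" using n by auto
        hence "(\<Sum>i\<in>{1..<n}. t i) = t 1 + (\<Sum>i\<in>{2..<n}. t i)" by simp
        also have "(\<Sum>i\<in>{2..<n}. t i) = (\<Sum>i\<in>{2..<n}. ln \<bar>z $ i\<bar>)"
          by (intro sum.cong) (auto simp: t_def)
        finally have "z $ 1 * (t 0 * Y + (\<Sum>i\<in>{1..<n}. t i)) = z $ 0"
          using z1 by (simp add: t_def)
        moreover have "(\<lambda>l. v l $ 0) \<longlonglongrightarrow> z $ 1 * (t 0 * Y + (\<Sum>i\<in>{1..<n}. t i))"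
          unfolding v0 by (intro tendsto_intros lim1 lim) (use n in auto)
        ultimately show ?thesis using 1 by simp
      next
        case 3
        have "(\<lambda>l. (- 1) ^ (if z $ j < 0 then 1 else 0 :: nat) *
            exp (real (m l j) - real (k l) * \<theta> j)) \<longlonglongrightarrow>
            (- 1) ^ (if z $ j < 0 then 1 else 0 :: nat) * exp (t j)"
          by (intro tendsto_intros lim j)
        also have "exp (t j) = \<bar>z $ j\<bar>" using 3 nz[of j] j by (simp add: t_def)
        finally show ?thesis unfolding vj[OF 3 j] neg_one[OF m[OF j]] sgn .
      qed (use lim1 in simp)
    qed
    hence "\<forall>\<^sub>F l in sequentially. \<forall>j\<in>{..<n}. \<bar>v l $ j - z $ j\<bar> < e"
      using e by (intro eventually_ball_finite) (auto simp: tendsto_iff dist_real_def)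
    then obtain l where "\<forall>j\<in>{..<n}. \<bar>v l $ j - z $ j\<bar> < e"
      using eventually_happens'[OF sequentially_bot] by blast
    with v show ?thesis by blast
  qed

  have carr: "set Ts \<subseteq> carrier_mat n n"
    using size_two_block_jordan_carrier[OF n] by (auto simp: Ts_def)
  have x: "x \<in> carrier_vec n" by (simp add: x_def)
  have "dense_in_Rn n (tuple_orbit n Ts x)"
    unfolding dense_in_Rn_iff
  proof (intro conjI ballI allI impI subsetI)
    fix y assume "y \<in> tuple_orbit n Ts x"
    thus "y \<in> carrier_vec n"
      using tuple_orbit_invariant[OF _ carr x, of y "\<lambda>_. True"] by simp
  next
    fix z :: "real vec" and e :: real assume "z \<in> carrier_vec n" "e > 0"
    \<comment> \<open>Vanishing coordinates have no logarithm, so they are first moved by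
      \<open>e / 2\<close>.\<close>
    define z' where "z' = vec n (\<lambda>j. if z $ j = 0 then e / 2 else z $ j)"
    have "\<exists>v\<in>tuple_orbit n Ts x. \<forall>j<n. \<bar>v $ j - z' $ j\<bar> < e / 2"
      by (rule approx) (use \<open>e > 0\<close> in \<open>auto simp: z'_def\<close>)
    then obtain v where v: "v \<in> tuple_orbit n Ts x" "\<And>j. j < n \<Longrightarrow> \<bar>v $ j - z' $ j\<bar> < e / 2"
      by blast
    have "\<bar>v $ j - z $ j\<bar> < e" if "j < n" for j
    proof -
      have "\<bar>z' $ j - z $ j\<bar> \<le> e / 2" using that \<open>e > 0\<close> by (simp add: z'_def)
      with v(2)[OF that] show ?thesis by linarith
    qed
    with v(1) show "\<exists>s\<in>tuple_orbit n Ts x. \<forall>i<n. \<bar>s $ i - z $ i\<bar> < e" by blast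
  qed
  moreover have "\<forall>A\<in>set Ts. \<forall>B\<in>set Ts. A * B = B * A"
    using size_two_block_jordan_commute[OF n] by (auto simp: Ts_def)
  ultimately show ?thesis
    using len jordan carr x unfolding hypercyclic_tuple_def by blast
qed

theorem corollary1p12:
  fixes n :: nat
  assumes "n \<ge> 2"
  shows "(\<exists>Ts. length Ts = n + 1 \<and> jordan_tuple n Ts \<and> hypercyclic_tuple n Ts) \<and>
    (\<forall>k\<ge>1. (\<exists>Ts. length Ts = k \<and> jordan_tuple n Ts \<and> hypercyclic_tuple n Ts) \<longrightarrow> n + 1 \<le> k)"
  using exists_hypercyclic_jordan_tuple[OF assms] jordan_tuple_hypercyclic_length by blast

end
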